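(* Every $\pi$-adequate ring is J-stable.
   Context: All rings are commutative with identity. $J(R)$ denotes the Jacobson radical of $R$; $\mathbb{N}$ denotes the positive integers. A ring is a Bézout ring if every finitely generated ideal is principal. An element $a\in R$ is adequate if for every $b\in R$ there exist $r,s\in R$ such that (1) $a=rs$; (2) $rR+bR=R$; (3) $s'R+bR\neq R$ for each non-invertible divisor $s'$ of $s$. A $\pi$-adequate ring is a Bézout ring $R$ such that for every nonzero $a\in R$ there exists $n\in\mathbb{N}$ such that $a^n$ is adequate. A ring $R$ has stable range $1$ if whenever $aR+bR=R$ with $a,b\in R$, there is $y\in R$ such that $a+by$ is invertible. A ring $R$ is J-stable if $R/aR$ has stable range $1$ for all $a\in R$ with $a\notin J(R)$. *)

theory Defs
  imports "HOL-Algebra.Algebra"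
begin

definition jacobson_radical :: "('a, 'm) ring_scheme \<Rightarrow> 'a set" where
  "jacobson_radical R = {x \<in> carrier R. \<forall>M. maximalideal M R \<longrightarrow> x \<in> M}"

definition bezout_ring :: "('a, 'm) ring_scheme \<Rightarrow> bool" where
  "bezout_ring R \<longleftrightarrow> cring R \<and>
     (\<forall>A. finite A \<and> A \<subseteq> carrier R \<longrightarrow> principalideal (Idl\<^bsub>R\<^esub> A) R)"

definition adequate :: "('a, 'm) ring_scheme \<Rightarrow> 'a \<Rightarrow> bool" where
  "adequate R a \<longleftrightarrow> a \<in> carrier R \<and>
     (\<forall>b\<in>carrier R. \<exists>r\<in>carrier R. \<exists>s\<in>carrier R.
        a = r \<otimes>\<^bsub>R\<^esub> s \<and>
        PIdl\<^bsub>R\<^esub> r <+>\<^bsub>R\<^esub> PIdl\<^bsub>R\<^esub> b = carrier R \<and>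
        (\<forall>s'\<in>carrier R. s' divides\<^bsub>R\<^esub> s \<and> s' \<notin> Units R \<longrightarrow>
           PIdl\<^bsub>R\<^esub> s' <+>\<^bsub>R\<^esub> PIdl\<^bsub>R\<^esub> b \<noteq> carrier R))"

definition pi_adequate_ring :: "('a, 'm) ring_scheme \<Rightarrow> bool" where
  "pi_adequate_ring R \<longleftrightarrow> bezout_ring R \<and>
     (\<forall>a\<in>carrier R. a \<noteq> \<zero>\<^bsub>R\<^esub> \<longrightarrow> (\<exists>n::nat. n \<ge> 1 \<and> adequate R (a [^]\<^bsub>R\<^esub> n)))"

definition stable_range_one :: "('a, 'm) ring_scheme \<Rightarrow> bool" where
  "stable_range_one R \<longleftrightarrow> cring R \<and>
     (\<forall>a\<in>carrier R. \<forall>b\<in>carrier R.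
        PIdl\<^bsub>R\<^esub> a <+>\<^bsub>R\<^esub> PIdl\<^bsub>R\<^esub> b = carrier R \<longrightarrow>
        (\<exists>y\<in>carrier R. a \<oplus>\<^bsub>R\<^esub> b \<otimes>\<^bsub>R\<^esub> y \<in> Units R))"

definition J_stable :: "('a, 'm) ring_scheme \<Rightarrow> bool" where
  "J_stable R \<longleftrightarrow> cring R \<and>
     (\<forall>a\<in>carrier R. a \<notin> jacobson_radical R \<longrightarrow> stable_range_one (R Quot (PIdl\<^bsub>R\<^esub> a)))"

end

theory Submission
  imports Defs
begin

text \<open>
  Fix a nonzero \<open>a\<close> and \<open>n \<ge> 1\<close> with \<open>a^n\<close> adequate, and let \<open>xR + yR + aR = R\<close>. For stable
  range 1 of \<open>R/aR\<close> it suffices to find \<open>t\<close> such that \<open>x + yt\<close> is invertible modulo \<open>a\<close>. Apply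
  adequacy of \<open>a^n\<close> to \<open>b = x\<close>: this gives \<open>a^n = rs\<close> with \<open>rR + xR = R\<close>, while no nonunit
  divisor of \<open>s\<close> is comaximal with \<open>x\<close>. The choice \<open>t = r\<close> works.

  In terms of maximal ideals: one that contains \<open>r\<close> omits \<open>x\<close>, hence omits \<open>z = x + yr\<close>. Suppose
  that \<open>s\<close> and \<open>z\<close> have a nonunit greatest common divisor \<open>d\<close>. As \<open>d\<close> divides \<open>s\<close>, it lies
  together with \<open>x\<close> in a maximal ideal, which then contains \<open>yr = z - x\<close>; it does not contain
  \<open>r\<close>, so it contains \<open>y\<close>. It also contains \<open>a^n = rs\<close>, hence \<open>a\<close>, contradicting
  \<open>xR + yR + aR = R\<close>. So \<open>z\<close> is comaximal with \<open>r\<close> and with \<open>s\<close>, hence with \<open>a^n\<close> and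
  with \<open>a\<close>.

  Below, maximal ideals are replaced by greatest common divisors (\<open>bezout_gcd\<close>): instead of a
  maximal ideal containing \<open>d\<close> and \<open>x\<close>, one takes a common divisor of \<open>d\<close> and \<open>x\<close>. The
  argument is \<open>comaximal_shift_of_adequate_power\<close>; \<open>Quot_stable_range_one\<close> carries it to the
  quotient ring.
\<close>

section \<open>Comaximal elements\<close>

definition comaximal :: "('a, 'm) ring_scheme \<Rightarrow> 'a \<Rightarrow> 'a \<Rightarrow> bool" where
  "comaximal R a b \<longleftrightarrow>
     (\<exists>u\<in>carrier R. \<exists>v\<in>carrier R. u \<otimes>\<^bsub>R\<^esub> a \<oplus>\<^bsub>R\<^esub> v \<otimes>\<^bsub>R\<^esub> b = \<one>\<^bsub>R\<^esub>)"

context cring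
begin

lemma PIdl_sum_eq_carrier_iff_comaximal:
  assumes a: "a \<in> carrier R" and b: "b \<in> carrier R"
  shows "PIdl a <+>\<^bsub>R\<^esub> PIdl b = carrier R \<longleftrightarrow> comaximal R a b"
proof -
  interpret S: ideal "PIdl a <+>\<^bsub>R\<^esub> PIdl b" R
    by (intro add_ideals cgenideal_ideal a b)
  have "PIdl a <+>\<^bsub>R\<^esub> PIdl b = carrier R \<longleftrightarrow> \<one> \<in> PIdl a <+>\<^bsub>R\<^esub> PIdl b"
    using S.one_imp_carrier by auto
  also have "\<dots> \<longleftrightarrow> comaximal R a b"
    unfolding comaximal_def set_add_def' cgenideal_def by (simp, metis)
  finally show ?thesis .
qed

lemma comaximal_divides:
  assumes ab: "comaximal R a b"
    and a': "a' \<in> carrier R" "a' divides a" and b': "b' \<in> carrier R" "b' divides b"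
  shows "comaximal R a' b'"
proof -
  from ab obtain u v where uv: "u \<in> carrier R" "v \<in> carrier R" "u \<otimes> a \<oplus> v \<otimes> b = \<one>"
    by (auto simp: comaximal_def)
  from a' obtain c where c: "c \<in> carrier R" "a = a' \<otimes> c" by (auto simp: factor_def)
  from b' obtain d where d: "d \<in> carrier R" "b = b' \<otimes> d" by (auto simp: factor_def)
  have "(u \<otimes> c) \<otimes> a' \<oplus> (v \<otimes> d) \<otimes> b' = \<one>"
    using uv c d a' b' by (simp add: m_ac)
  then show ?thesis
    using uv c d unfolding comaximal_def by (meson m_closed)
qed

lemma divides_combination:
  assumes "e \<in> carrier R" "x \<in> carrier R" "y \<in> carrier R" "p \<in> carrier R" "q \<in> carrier R"
    and "e divides x" "e divides y"
  shows "e divides (p \<otimes> x \<oplus> q \<otimes> y)"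
proof -
  obtain x' y' where x': "x' \<in> carrier R" "x = e \<otimes> x'" and y': "y' \<in> carrier R" "y = e \<otimes> y'"
    using assms by (auto simp: factor_def)
  have "p \<otimes> x \<oplus> q \<otimes> y = e \<otimes> (p \<otimes> x' \<oplus> q \<otimes> y')"
    using assms(1-5) x' y' by (simp add: r_distr m_lcomm)
  then show ?thesis using assms x' y' by (intro dividesI) auto
qed

text \<open>
  The next two lemmas concern the passage from \<open>x\<close> to \<open>x + yr\<close> when \<open>rR + xR = R\<close>. The first
  holds because \<open>x\<close> and \<open>x + yr\<close> agree modulo \<open>r\<close>. For the second, a common divisor of \<open>x\<close> and
  \<open>x + yr\<close> divides \<open>yr\<close>, and \<open>r\<close> is invertible modulo every divisor of \<open>x\<close>, so that \<open>r\<close> can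
  be cancelled.
\<close>

lemma comaximal_shear:
  assumes carr: "r \<in> carrier R" "x \<in> carrier R" "y \<in> carrier R"
    and rx: "comaximal R r x"
  shows "comaximal R (x \<oplus> y \<otimes> r) r"
proof -
  obtain u v where uv: "u \<in> carrier R" "v \<in> carrier R" "u \<otimes> r \<oplus> v \<otimes> x = \<one>"
    using rx by (auto simp: comaximal_def)
  have "v \<otimes> (x \<oplus> y \<otimes> r) \<oplus> (u \<ominus> v \<otimes> y) \<otimes> r = u \<otimes> r \<oplus> v \<otimes> x"
    using carr uv(1,2) by algebra
  then show ?thesis
    unfolding comaximal_def uv(3) using carr uv(1,2) by (meson m_closed minus_closed)
qed

lemma divides_shear:
  assumes carr: "r \<in> carrier R" "x \<in> carrier R" "y \<in> carrier R" "e \<in> carrier R"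
    and rx: "comaximal R r x" and e: "e divides x" "e divides (x \<oplus> y \<otimes> r)"
  shows "e divides y"
proof -
  obtain u v where uv: "u \<in> carrier R" "v \<in> carrier R" "u \<otimes> r \<oplus> v \<otimes> x = \<one>"
    using rx by (auto simp: comaximal_def)
  have "u \<otimes> (x \<oplus> y \<otimes> r) \<oplus> (y \<otimes> v \<ominus> u) \<otimes> x = y \<otimes> (u \<otimes> r \<oplus> v \<otimes> x)"
    using carr uv(1,2) by algebra
  also have "\<dots> = y" using carr uv(3) by simp
  finally have "y = u \<otimes> (x \<oplus> y \<otimes> r) \<oplus> (y \<otimes> v \<ominus> u) \<otimes> x" ..
  moreover have "e divides (u \<otimes> (x \<oplus> y \<otimes> r) \<oplus> (y \<otimes> v \<ominus> u) \<otimes> x)"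
    using carr uv(1,2) e by (intro divides_combination) auto
  ultimately show ?thesis by simp
qed

text \<open>
  An element that is comaximal with two others is comaximal with their product, because the
  units of \<open>R/aR\<close> are closed under multiplication.
\<close>

lemma comaximal_mult:
  assumes [simp]: "a \<in> carrier R" "b \<in> carrier R" "c \<in> carrier R"
    and "comaximal R a b" "comaximal R a c"
  shows "comaximal R a (b \<otimes> c)"
proof -
  obtain u v where [simp]: "u \<in> carrier R" "v \<in> carrier R" and uv: "u \<otimes> a \<oplus> v \<otimes> b = \<one>"
    using assms(4) by (auto simp: comaximal_def)
  obtain p q where [simp]: "p \<in> carrier R" "q \<in> carrier R" and pq: "p \<otimes> a \<oplus> q \<otimes> c = \<one>"
    using assms(5) by (auto simp: comaximal_def)
  have "(u \<oplus> v \<otimes> b \<otimes> p) \<otimes> a \<oplus> (v \<otimes> q) \<otimes> (b \<otimes> c)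
      = u \<otimes> a \<oplus> v \<otimes> b \<otimes> (p \<otimes> a \<oplus> q \<otimes> c)"
    by (simp add: l_distr r_distr m_ac a_ac)
  also have "\<dots> = \<one>" using uv pq by simp
  finally show ?thesis
    unfolding comaximal_def by (intro bexI) auto
qed

lemma comaximal_one: "a \<in> carrier R \<Longrightarrow> comaximal R a \<one>"
  unfolding comaximal_def by (intro bexI[of _ \<zero>] bexI[of _ \<one>]) auto

lemma comaximal_pow:
  assumes "a \<in> carrier R" "b \<in> carrier R" "comaximal R a b"
  shows "comaximal R a (b [^] (n::nat))"
  by (induction n) (use assms in \<open>auto intro: comaximal_mult comaximal_one\<close>)

lemma comaximal_divisor_is_unit:
  assumes "comaximal R e b" "e \<in> carrier R" "e divides b"
  shows "e \<in> Units R"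
proof -
  have "comaximal R e e"
    using comaximal_divides[OF assms(1,2) divides_refl[OF assms(2)] assms(2,3)] .
  then obtain u v where "u \<in> carrier R" "v \<in> carrier R" "u \<otimes> e \<oplus> v \<otimes> e = \<one>"
    by (auto simp: comaximal_def)
  then have "u \<oplus> v \<in> carrier R" "e \<otimes> (u \<oplus> v) = \<one>"
    using assms(2) by (auto simp: r_distr m_comm)
  then show ?thesis
    using assms(2) by (metis unit_factor Units_one_closed)
qed

lemma comaximal_if_unit_combination:
  assumes [simp]: "a \<in> carrier R" "b \<in> carrier R" "u \<in> carrier R" "v \<in> carrier R"
    and unit: "u \<otimes> a \<oplus> v \<otimes> b \<in> Units R"
  shows "comaximal R a b"
proof -
  let ?d = "u \<otimes> a \<oplus> v \<otimes> b"
  have [simp]: "inv ?d \<in> carrier R" using unit by simp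
  have "(inv ?d \<otimes> u) \<otimes> a \<oplus> (inv ?d \<otimes> v) \<otimes> b = inv ?d \<otimes> ?d"
    by (simp add: r_distr m_assoc)
  also have "\<dots> = \<one>" using unit by simp
  finally show ?thesis
    unfolding comaximal_def by (intro bexI) auto
qed

section \<open>Lifting units along an adequate power\<close>

text \<open>
  The generator of the ideal \<open>aR + bR\<close> is a common divisor of \<open>a\<close> and \<open>b\<close>. It is stated as an
  explicit combination, since a unit of that form makes \<open>a\<close> and \<open>b\<close> comaximal.
\<close>

lemma bezout_gcd:
  assumes bez: "bezout_ring R" and a: "a \<in> carrier R" and b: "b \<in> carrier R"
  obtains u v where "u \<in> carrier R" "v \<in> carrier R"
    "(u \<otimes> a \<oplus> v \<otimes> b) divides a" "(u \<otimes> a \<oplus> v \<otimes> b) divides b"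
proof -
  have "principalideal (Idl {a, b}) R"
    using bez a b by (simp add: bezout_ring_def)
  then obtain d where d: "d \<in> carrier R" and gen: "Idl {a, b} = Idl {d}"
    using principalideal.generate by blast
  have pid: "Idl {d} = PIdl d" using cgenideal_eq_genideal d by simp
  have "{a, b} \<subseteq> PIdl d" using genideal_self[of "{a,b}"] a b gen pid by auto
  then have div: "d divides a" "d divides b"
    using d by (auto simp: cgenideal_def factor_def m_comm)
  interpret S: ideal "PIdl a <+>\<^bsub>R\<^esub> PIdl b" R
    by (intro add_ideals cgenideal_ideal a b)
  have "a = \<one> \<otimes> a \<oplus> \<zero> \<otimes> b" "b = \<zero> \<otimes> a \<oplus> \<one> \<otimes> b" using a b by auto
  then have "{a, b} \<subseteq> PIdl a <+>\<^bsub>R\<^esub> PIdl b"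
    unfolding set_add_def' cgenideal_def by blast
  then have "Idl {a, b} \<subseteq> PIdl a <+>\<^bsub>R\<^esub> PIdl b"
    by (rule genideal_minimal[OF S.is_ideal])
  moreover have "d \<in> Idl {a, b}" using gen pid cgenideal_self d by simp
  ultimately obtain u v where "u \<in> carrier R" "v \<in> carrier R" "d = u \<otimes> a \<oplus> v \<otimes> b"
    unfolding set_add_def' cgenideal_def by blast
  with div that show thesis by blast
qed

text \<open>
  The heart of the proof. The hypothesis \<open>cov\<close> records \<open>xR + yR + aR = R\<close> with fixed
  coefficients of \<open>x\<close> and \<open>y\<close>: a common divisor of \<open>x\<close> and \<open>y\<close> is then at once comaximal with
  \<open>a\<close>, hence with every power of \<open>a\<close>.
\<close>

lemma comaximal_shift_of_adequate_power:
  assumes bez: "bezout_ring R" and adq: "adequate R (a [^] (n::nat))"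
    and n: "n \<ge> 1"
    and [simp]: "a \<in> carrier R" "x \<in> carrier R" "y \<in> carrier R" "p \<in> carrier R" "q \<in> carrier R"
    and cov: "comaximal R (p \<otimes> x \<oplus> q \<otimes> y) a"
  shows "\<exists>t\<in>carrier R. comaximal R (x \<oplus> y \<otimes> t) a"
proof -
  from adq obtain r s where [simp]: "r \<in> carrier R" "s \<in> carrier R"
    and rs: "a [^] n = r \<otimes> s" and rx: "PIdl r <+>\<^bsub>R\<^esub> PIdl x = carrier R"
    and maxs: "\<And>s'. \<lbrakk>s' \<in> carrier R; s' divides s; s' \<notin> Units R\<rbrakk>
                 \<Longrightarrow> PIdl s' <+>\<^bsub>R\<^esub> PIdl x \<noteq> carrier R"
    unfolding adequate_def by (metis assms(5))
  have rx: "comaximal R r x" using rx PIdl_sum_eq_carrier_iff_comaximal by simp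
  \<comment> \<open>The witness is \<open>t = r\<close>: it vanishes modulo \<open>r\<close>, where \<open>x\<close> is already invertible.\<close>
  let ?z = "x \<oplus> y \<otimes> r"
  have z: "?z \<in> carrier R" by simp
  have zr: "comaximal R ?z r"
    by (rule comaximal_shear[OF _ _ _ rx]) simp_all
  have zs: "comaximal R ?z s"
  proof -
    obtain u v where [simp]: "u \<in> carrier R" "v \<in> carrier R"
      and dz: "(u \<otimes> ?z \<oplus> v \<otimes> s) divides ?z" and ds: "(u \<otimes> ?z \<oplus> v \<otimes> s) divides s"
      using bezout_gcd[OF bez z \<open>s \<in> carrier R\<close>] by blast
    define d where "d = u \<otimes> ?z \<oplus> v \<otimes> s"
    have [simp]: "d \<in> carrier R" by (simp add: d_def)
    \<comment> \<open>The common divisor \<open>e\<close> of \<open>d\<close> and \<open>x\<close> divides \<open>x\<close>, \<open>y\<close> and \<open>a^n\<close>, which forces it to be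
      a unit; thus \<open>d\<close> is a divisor of \<open>s\<close> that is comaximal with \<open>x\<close>, and adequacy makes
      \<open>d\<close> itself a unit.\<close>
    obtain g h where [simp]: "g \<in> carrier R" "h \<in> carrier R"
      and ed: "(g \<otimes> d \<oplus> h \<otimes> x) divides d" and ex: "(g \<otimes> d \<oplus> h \<otimes> x) divides x"
      using bezout_gcd[OF bez \<open>d \<in> carrier R\<close> \<open>x \<in> carrier R\<close>] by blast
    define e where "e = g \<otimes> d \<oplus> h \<otimes> x"
    have [simp]: "e \<in> carrier R" by (simp add: e_def)
    have "e divides x" "e divides d"
      using ex ed by (simp_all only: e_def)
    have "d divides ?z" "d divides s"
      using dz ds by (simp_all only: d_def)
    have "e divides ?z"
      by (rule divides_trans[OF \<open>e divides d\<close> \<open>d divides ?z\<close> \<open>e \<in> carrier R\<close>])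
    have "e divides s"
      by (rule divides_trans[OF \<open>e divides d\<close> \<open>d divides s\<close> \<open>e \<in> carrier R\<close>])
    have "e divides y"
      by (rule divides_shear[OF _ _ _ _ rx \<open>e divides x\<close> \<open>e divides ?z\<close>]) simp_all
    have "e divides (p \<otimes> x \<oplus> q \<otimes> y)"
      by (rule divides_combination[OF _ _ _ _ _ \<open>e divides x\<close> \<open>e divides y\<close>]) simp_all
    then have "comaximal R e a"
      by (rule comaximal_divides[OF cov, rotated]) simp_all
    then have "comaximal R e (a [^] n)"
      using comaximal_pow[of e a n] by simp
    moreover have "e divides (a [^] n)"
      unfolding rs using divides_prod_l[of e s r] \<open>e divides s\<close> by simp
    ultimately have "e \<in> Units R"
      using comaximal_divisor_is_unit[of e "a [^] n"] \<open>e \<in> carrier R\<close> by blast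
    then have "comaximal R d x"
      using comaximal_if_unit_combination[of d x g h] by (simp add: e_def)
    then have "PIdl d <+>\<^bsub>R\<^esub> PIdl x = carrier R"
      by (subst PIdl_sum_eq_carrier_iff_comaximal) simp_all
    then have "d \<in> Units R"
      using maxs[OF \<open>d \<in> carrier R\<close> \<open>d divides s\<close>] by blast
    then show ?thesis
      using comaximal_if_unit_combination[of ?z s u v] by (simp add: d_def)
  qed
  have "comaximal R ?z (a [^] n)"
    unfolding rs by (rule comaximal_mult[OF _ _ _ zr zs]) simp_all
  moreover have "a divides (a [^] n)"
  proof (rule dividesI)
    show "a [^] (n - 1) \<in> carrier R" by simp
    have "a [^] n = a [^] Suc (n - 1)" using n by simp
    also have "\<dots> = a \<otimes> a [^] (n - 1)" by (rule nat_pow_Suc2) simp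
    finally show "a [^] n = a \<otimes> a [^] (n - 1)" .
  qed
  ultimately have "comaximal R ?z a"
    using comaximal_divides[of ?z "a [^] n" ?z a] by simp
  then show ?thesis using \<open>r \<in> carrier R\<close> by blast
qed

end

section \<open>Stable range one of a quotient\<close>

text \<open>
  The hypothesis \<open>one_iff\<close> says that the kernel of \<open>h\<close> is the principal ideal \<open>aR\<close>, phrased for
  congruences to \<open>\<one>\<close>. Both comaximality and invertibility in \<open>S\<close> are equations with
  right-hand side \<open>\<one>\<close>, so that it translates each of them into comaximality with \<open>a\<close> in \<open>R\<close>.
\<close>

lemma (in ring_hom_cring) stable_range_one_of_surjective:
  assumes surj: "h ` carrier R = carrier S"
    and one_iff: "\<And>w. w \<in> carrier R \<Longrightarrow> h w = \<one>\<^bsub>S\<^esub> \<longleftrightarrow> (\<exists>v\<in>carrier R. w \<oplus> v \<otimes> a = \<one>)"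
    and lift: "\<And>x y p q. \<lbrakk>x \<in> carrier R; y \<in> carrier R; p \<in> carrier R; q \<in> carrier R;
                 comaximal R (p \<otimes> x \<oplus> q \<otimes> y) a\<rbrakk>
               \<Longrightarrow> \<exists>t\<in>carrier R. comaximal R (x \<oplus> y \<otimes> t) a"
  shows "stable_range_one S"
  unfolding stable_range_one_def
proof (intro conjI ballI impI)
  show "cring S" by (rule S.is_cring)
  fix A B assume A: "A \<in> carrier S" and B: "B \<in> carrier S"
    and AB: "PIdl\<^bsub>S\<^esub> A <+>\<^bsub>S\<^esub> PIdl\<^bsub>S\<^esub> B = carrier S"
  obtain P Q where P: "P \<in> carrier S" and Q: "Q \<in> carrier S"
    and PQ: "P \<otimes>\<^bsub>S\<^esub> A \<oplus>\<^bsub>S\<^esub> Q \<otimes>\<^bsub>S\<^esub> B = \<one>\<^bsub>S\<^esub>"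
    using AB S.PIdl_sum_eq_carrier_iff_comaximal[OF A B] by (auto simp: comaximal_def)
  obtain x y p q where carr: "x \<in> carrier R" "y \<in> carrier R" "p \<in> carrier R" "q \<in> carrier R"
    and img: "A = h x" "B = h y" "P = h p" "Q = h q"
    using A B P Q unfolding surj[symmetric] by blast
  have "h (p \<otimes> x \<oplus> q \<otimes> y) = \<one>\<^bsub>S\<^esub>"
    using PQ carr by (simp add: img)
  then obtain v where "v \<in> carrier R" "(p \<otimes> x \<oplus> q \<otimes> y) \<oplus> v \<otimes> a = \<one>"
    using one_iff[of "p \<otimes> x \<oplus> q \<otimes> y"] carr by (meson R.a_closed R.m_closed)
  then have "comaximal R (p \<otimes> x \<oplus> q \<otimes> y) a"
    unfolding comaximal_def using carr by (intro bexI[of _ \<one>] bexI[of _ v]) auto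
  then obtain t where t: "t \<in> carrier R" and "comaximal R (x \<oplus> y \<otimes> t) a"
    using lift[OF carr] by blast
  then obtain u v where u: "u \<in> carrier R" and "v \<in> carrier R"
    "u \<otimes> (x \<oplus> y \<otimes> t) \<oplus> v \<otimes> a = \<one>" by (auto simp: comaximal_def)
  then have "h (u \<otimes> (x \<oplus> y \<otimes> t)) = \<one>\<^bsub>S\<^esub>"
    using one_iff[of "u \<otimes> (x \<oplus> y \<otimes> t)"] carr t by (meson R.a_closed R.m_closed)
  then have "(A \<oplus>\<^bsub>S\<^esub> B \<otimes>\<^bsub>S\<^esub> h t) \<otimes>\<^bsub>S\<^esub> h u = \<one>\<^bsub>S\<^esub>"
    using carr t u by (simp add: img S.m_comm)
  then have "A \<oplus>\<^bsub>S\<^esub> B \<otimes>\<^bsub>S\<^esub> h t \<in> Units S"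
    using S.unit_factor[of "A \<oplus>\<^bsub>S\<^esub> B \<otimes>\<^bsub>S\<^esub> h t" "h u"] A B t u by simp
  then show "\<exists>T\<in>carrier S. A \<oplus>\<^bsub>S\<^esub> B \<otimes>\<^bsub>S\<^esub> T \<in> Units S"
    using t hom_closed by blast
qed

context cring
begin

lemma Quot_coset_eq_one_iff:
  assumes [simp]: "a \<in> carrier R" "w \<in> carrier R"
  shows "PIdl a +> w = \<one>\<^bsub>R Quot PIdl a\<^esub> \<longleftrightarrow> (\<exists>v\<in>carrier R. w \<oplus> v \<otimes> a = \<one>)"
proof -
  interpret I: ideal "PIdl a" R by (rule cgenideal_ideal) simp
  interpret h: ring_hom_cring R "R Quot PIdl a" "(+>) (PIdl a)"
    by (rule I.rcos_ring_hom_cring[OF is_cring])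
  show ?thesis
  proof
    assume "PIdl a +> w = \<one>\<^bsub>R Quot PIdl a\<^esub>"
    then have "PIdl a +> w = PIdl a +> \<one>" by (simp only: h.hom_one)
    then have "\<one> \<in> PIdl a +> w"
      using I.a_rcos_self[OF one_closed] by (simp only:)
    then obtain v where "v \<in> carrier R" "\<one> = v \<otimes> a \<oplus> w"
      unfolding a_r_coset_def' cgenideal_def by blast
    then show "\<exists>v\<in>carrier R. w \<oplus> v \<otimes> a = \<one>"
      using a_comm[of w] by (intro bexI[of _ v]) simp_all
  next
    assume "\<exists>v\<in>carrier R. w \<oplus> v \<otimes> a = \<one>"
    then obtain v where [simp]: "v \<in> carrier R" and v: "w \<oplus> v \<otimes> a = \<one>" by blast
    have "v \<otimes> a \<in> PIdl a"
      unfolding cgenideal_def using \<open>v \<in> carrier R\<close> by blast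
    then have "PIdl a +> (v \<otimes> a \<oplus> w) = PIdl a +> w"
      using a_coset_add_assoc[OF I.a_subset, of "v \<otimes> a" w] by (simp add: I.a_rcos_const)
    moreover have "v \<otimes> a \<oplus> w = \<one>"
      using v a_comm[of w "v \<otimes> a"] by simp
    ultimately have "PIdl a +> w = PIdl a +> \<one>" by (simp only:)
    then show "PIdl a +> w = \<one>\<^bsub>R Quot PIdl a\<^esub>" by (simp only: h.hom_one)
  qed
qed

lemma Quot_stable_range_one:
  assumes a: "a \<in> carrier R"
    and lift: "\<And>x y p q. \<lbrakk>x \<in> carrier R; y \<in> carrier R; p \<in> carrier R; q \<in> carrier R;
                 comaximal R (p \<otimes> x \<oplus> q \<otimes> y) a\<rbrakk>
               \<Longrightarrow> \<exists>t\<in>carrier R. comaximal R (x \<oplus> y \<otimes> t) a"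
  shows "stable_range_one (R Quot (PIdl a))"
proof (rule ring_hom_cring.stable_range_one_of_surjective)
  show "ring_hom_cring R (R Quot (PIdl a)) ((+>) (PIdl a))"
    by (rule ideal.rcos_ring_hom_cring[OF cgenideal_ideal[OF a] is_cring])
  show "(+>) (PIdl a) ` carrier R = carrier (R Quot (PIdl a))"
    by (auto simp: FactRing_def A_RCOSETS_def')
  show "PIdl a +> w = \<one>\<^bsub>R Quot (PIdl a)\<^esub> \<longleftrightarrow> (\<exists>v\<in>carrier R. w \<oplus> v \<otimes> a = \<one>)"
    if "w \<in> carrier R" for w
    by (rule Quot_coset_eq_one_iff[OF a that])
qed (use a lift in auto)

end

section \<open>Pi-adequate rings are J-stable\<close>

theorem theorem3p8:
  fixes R :: "('a, 'm) ring_scheme"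
  assumes "pi_adequate_ring R"
  shows "J_stable R"
proof -
  have bez: "bezout_ring R" using assms by (simp add: pi_adequate_ring_def)
  interpret cring R using bez by (simp add: bezout_ring_def)
  have "stable_range_one (R Quot (PIdl\<^bsub>R\<^esub> a))"
    if a: "a \<in> carrier R" "a \<notin> jacobson_radical R" for a
  proof -
    \<comment> \<open>The hypothesis on the ring provides adequate powers of nonzero elements, and \<open>\<zero>\<close> lies in
      the Jacobson radical.\<close>
    have "\<zero>\<^bsub>R\<^esub> \<in> jacobson_radical R"
      by (auto simp: jacobson_radical_def maximalideal_def ideal_def
               intro: additive_subgroup.zero_closed)
    with a have "a \<noteq> \<zero>\<^bsub>R\<^esub>" by blast
    then obtain n :: nat where n: "n \<ge> 1" "adequate R (a [^]\<^bsub>R\<^esub> n)"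
      using assms a by (auto simp: pi_adequate_ring_def)
    show ?thesis
      by (intro Quot_stable_range_one comaximal_shift_of_adequate_power[OF bez n(2,1)] a)
  qed
  then show ?thesis by (simp add: J_stable_def is_cring)
qed

end
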